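(* For every constant number of passes $k$ there is a family of graphs on $O(n)$ vertices with $m=\Theta(n\sqrt{T})$ edges, each either triangle-free or having at least $T$ triangles, such that any $k$-pass randomized streaming algorithm solving $\mathsf{Dist}(T)$ on this family requires $\Omega(n)=\Omega(m/\sqrt{T})$ space. Consequently, for any constant $\rho>0$ there is no constant-pass streaming algorithm for $\mathsf{Dist}(T)$ that uses $O\!\left(\frac{m}{T^{1/2+\rho}}\right)$ space.
   Context: $\mathsf{Dist}(T)$ is the problem: given a stream of the edges of a graph, distinguish (with constant success probability) graphs with at least $T$ triangles from triangle-free graphs. Here $T$ is a perfect square with $\sqrt{T}\le n$. *)

theory Defs
  imports "HOL-Probability.Probability_Mass_Function"
begin

definition graph_on :: "nat \<Rightarrow> nat set set \<Rightarrow> bool" where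
  "graph_on V E \<longleftrightarrow> (\<forall>e\<in>E. card e = 2 \<and> e \<subseteq> {..<V})"

definition triangles :: "nat set set \<Rightarrow> nat set set" where
  "triangles E = {S. card S = 3 \<and> (\<forall>x\<in>S. \<forall>y\<in>S. x \<noteq> y \<longrightarrow> {x, y} \<in> E)}"

definition is_stream_of :: "nat set list \<Rightarrow> nat set set \<Rightarrow> bool" where
  "is_stream_of xs E \<longleftrightarrow> distinct xs \<and> set xs = E"

text \<open>Randomized multi-pass streaming algorithm.  A random seed is drawn from
the distribution seed (public randomness, not charged to the space);
the memory state is a natural number; st_init gives the initial state;
st_step r i e q is the new memory after reading edge e in pass i with memory q;
st_out r q is the final answer (True = "at least T triangles").\<close>

record stream_alg =
  seed :: "nat pmf"
  st_init :: "nat \<Rightarrow> nat"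
  st_step :: "nat \<Rightarrow> nat \<Rightarrow> nat set \<Rightarrow> nat \<Rightarrow> nat"
  st_out :: "nat \<Rightarrow> nat \<Rightarrow> bool"

definition space_bounded :: "stream_alg \<Rightarrow> nat \<Rightarrow> bool" where
  "space_bounded A s \<longleftrightarrow>
     (\<forall>r. st_init A r < 2 ^ s) \<and> (\<forall>r i e q. st_step A r i e q < 2 ^ s)"

definition run_pass :: "stream_alg \<Rightarrow> nat \<Rightarrow> nat \<Rightarrow> nat set list \<Rightarrow> nat \<Rightarrow> nat" where
  "run_pass A r i xs q = fold (st_step A r i) xs q"

definition run_alg :: "stream_alg \<Rightarrow> nat \<Rightarrow> nat \<Rightarrow> nat set list \<Rightarrow> nat" where
  "run_alg A k r xs = fold (\<lambda>i q. run_pass A r i xs q) [0..<k] (st_init A r)"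

text \<open>A k-pass algorithm solves Dist(T) on the family F if for every graph of F and
every order of its edge stream, with probability at least 2/3 it answers correctly
whether the graph has at least T triangles (graphs of F are promised to be
triangle-free or to have at least T triangles).\<close>

definition solves_Dist :: "stream_alg \<Rightarrow> nat \<Rightarrow> nat \<Rightarrow> nat set set set \<Rightarrow> bool" where
  "solves_Dist A k T F \<longleftrightarrow>
     (\<forall>E\<in>F. \<forall>xs. is_stream_of xs E \<longrightarrow>
        measure_pmf.prob (seed A)
          {r. st_out A r (run_alg A k r xs) = (card (triangles E) \<ge> T)} \<ge> 2/3)"

end

theory Submission
  imports Defs "HOL-Probability.Hoeffding"
begin

text \<open>Set disjointness on \<open>n\<close> elements embeds into \<open>Dist(T)\<close>, \<open>T = t\<^sup>2\<close>: join element \<open>i\<close> to all of a block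
  of \<open>t\<close> vertices if \<open>i \<in> x\<close>, to all of a second such block if \<open>i \<in> y\<close>, and join the two blocks completely;
  every common element then yields \<open>t\<^sup>2\<close> triangles, and there are no other triangles. A \<open>k\<close>-pass
  algorithm with \<open>s\<close> bits of memory gives a protocol with transcripts of \<open>2 k s\<close> bits.

  Disjointness is bounded as in the information-complexity argument of Bar-Yossef, Jayram, Kumar and
  Sivakumar, by elementary counting: fix a random assignment \<open>D\<close> of the
  coordinates to the players, so that the inputs \<open>z - D\<close> and \<open>z \<inter> D\<close> are governed by one uniform
  set \<open>z\<close>. By the level-1 inequality, for most coordinates the transcript hardly changes in Hellinger distance
  when its owner flips that coordinate. Transcripts are rectangles, so the distance between the inputs with
  bits \<open>00\<close> and \<open>11\<close> in a coordinate equals that between \<open>01\<close> and \<open>10\<close>, which is small by the triangle inequality;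
  but a correct protocol must tell \<open>00\<close> and \<open>11\<close> apart.\<close>

subsection \<open>Information carried by a function of a random set\<close>

text \<open>This is \<open>cosh w <= exp (w^2 / 2)\<close>, the subgaussian bound for a random sign:
  Hoeffding's lemma for a fair coin, extended to negative \<open>w\<close> by symmetry.\<close>

lemma exp_plus_exp_minus_le:
  fixes w :: real
  shows "exp w + exp (- w) \<le> 2 * exp (w\<^sup>2 / 2)"
proof -
  have *: "exp v + exp (- v) \<le> 2 * exp (v\<^sup>2 / 2)" if "v \<ge> 0" for v :: real
  proof -
    have "ln (1 + 1/2 * (exp (2 * v) - 1)) \<le> v + v\<^sup>2 / 2"
      using Hoeffdings_lemma_aux[of "2 * v" "1/2"] that by (simp add: power2_eq_square)
    moreover have "1 + 1/2 * (exp (2 * v) - 1) > 0"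
      by (simp add: field_simps add_pos_pos)
    ultimately have "1 + 1/2 * (exp (2 * v) - 1) \<le> exp (v + v\<^sup>2 / 2)"
      by (metis exp_le_cancel_iff exp_ln)
    then have "1 + exp (2 * v) \<le> 2 * exp (v + v\<^sup>2 / 2)"
      by (simp add: field_simps)
    then have "exp (- v) * (1 + exp (2 * v)) \<le> exp (- v) * (2 * exp (v + v\<^sup>2 / 2))"
      by (intro mult_left_mono) auto
    then show ?thesis
      by (simp add: algebra_simps mult_exp_exp)
  qed
  show ?thesis
    using *[of w] *[of "- w"] by (cases "w \<ge> 0") auto
qed

text \<open>The linear form \<open>u\<close>, whose coefficients are the biases \<open>w i\<close>
  of the coordinates on \<open>S\<close>, has mean \<open>W\<close> on \<open>S\<close>. Jensen
  bounds the sum of \<open>exp u\<close> below by \<open>card S * exp W\<close>; over the whole cube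
  this sum factors and is at most \<open>2 ^ card I * exp (W / 2)\<close>.\<close>

lemma level_one_inequality:
  fixes S :: "'a set set"
  assumes I: "finite I" and S: "S \<subseteq> Pow I" "S \<noteq> {}"
  defines "w \<equiv> \<lambda>i. (real (card {z \<in> S. i \<in> z}) - real (card {z \<in> S. i \<notin> z})) / real (card S)"
  shows "(\<Sum>i\<in>I. (w i)\<^sup>2) \<le> 2 * ln (2 ^ card I / real (card S))"
proof -
  define W where "W = (\<Sum>i\<in>I. (w i)\<^sup>2)"
  define u where "u = (\<lambda>z. \<Sum>i\<in>I. w i * (if i \<in> z then 1 else - 1))"
  have finS: "finite S"
    using S I by (meson finite_Pow_iff finite_subset)
  then have cS: "real (card S) > 0"
    using S by (simp add: card_gt_0_iff)
  have "(\<Sum>z\<in>S. u z) = (\<Sum>i\<in>I. w i * (\<Sum>z\<in>S. if i \<in> z then 1 else - 1))"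
    unfolding u_def sum_distrib_left by (rule sum.swap)
  also have "\<dots> = (\<Sum>i\<in>I. w i * (w i * card S))"
  proof (intro sum.cong refl arg_cong2[where f = "(*)"])
    fix i
    have "(\<Sum>z\<in>S. if i \<in> z then 1 else - 1 :: real) = real (card {z \<in> S. i \<in> z}) - real (card {z \<in> S. i \<notin> z})"
      using finS by (subst sum.If_cases) (auto simp: Int_def)
    then show "(\<Sum>z\<in>S. if i \<in> z then 1 else - 1) = w i * card S"
      using cS by (simp add: w_def)
  qed
  finally have u_sum: "(\<Sum>z\<in>S. u z) = W * card S"
    by (simp add: W_def sum_distrib_left power2_eq_square mult_ac)
  \<comment> \<open>Jensen through the tangent of \<open>exp\<close> at \<open>W\<close>: the linear
    terms cancel since \<open>u\<close> has mean \<open>W\<close> on \<open>S\<close>.\<close>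
  have "card S * exp W = (\<Sum>z\<in>S. exp W * (1 + (u z - W)))"
    unfolding sum_distrib_left[symmetric] by (simp add: sum.distrib sum_subtractf u_sum)
  also have "\<dots> \<le> (\<Sum>z\<in>S. exp W * exp (u z - W))"
    by (intro sum_mono mult_left_mono exp_ge_add_one_self) auto
  also have "\<dots> = (\<Sum>z\<in>S. exp (u z))"
    by (simp add: exp_diff)
  also have "\<dots> \<le> (\<Sum>z\<in>Pow I. exp (u z))"
    using I S by (intro sum_mono2) auto
  also have "\<dots> = (\<Sum>z\<in>Pow I. (\<Prod>i\<in>z. exp (w i)) * (\<Prod>i\<in>I - z. exp (- w i)))"
  proof (intro sum.cong refl)
    fix z assume z: "z \<in> Pow I"
    have "u z = (\<Sum>i\<in>I. if i \<in> z then w i else - w i)"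
      unfolding u_def by (intro sum.cong) auto
    also have "\<dots> = (\<Sum>i\<in>z. w i) + (\<Sum>i\<in>I - z. - w i)"
      using I z by (subst sum.If_cases) (auto simp: Int_absorb1 Diff_eq)
    finally show "exp (u z) = (\<Prod>i\<in>z. exp (w i)) * (\<Prod>i\<in>I - z. exp (- w i))"
      using I z by (simp add: exp_add exp_sum finite_subset del: sum_negf)
  qed
  also have "\<dots> = (\<Prod>i\<in>I. exp (w i) + exp (- w i))"
    by (rule prod_add[OF I, symmetric])
  also have "\<dots> \<le> (\<Prod>i\<in>I. 2 * exp ((w i)\<^sup>2 / 2))"
    by (intro prod_mono conjI exp_plus_exp_minus_le) (auto intro: add_nonneg_nonneg)
  also have "\<dots> = 2 ^ card I * exp (W / 2)"
    using I by (simp add: prod.distrib exp_sum[symmetric] W_def sum_divide_distrib)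
  finally have "card S * exp W \<le> 2 ^ card I * exp (W / 2)" .
  then have "card S * (exp (W / 2) * exp (W / 2)) \<le> 2 ^ card I * exp (W / 2)"
    by (simp add: mult_exp_exp)
  then have "exp (W / 2) \<le> 2 ^ card I / card S"
    using cS by (simp add: field_simps)
  then have "W / 2 \<le> ln (2 ^ card I / card S)"
    by (metis cS divide_pos_pos exp_le_cancel_iff exp_ln zero_less_numeral zero_less_power)
  then show ?thesis
    by (simp add: W_def)
qed

lemma power2_sqrt_diff_le:
  fixes a b :: real
  assumes "a \<ge> 0" "b \<ge> 0"
  shows "(a + b) * (sqrt a - sqrt b)\<^sup>2 \<le> (a - b)\<^sup>2"
proof -
  have "(a - b)\<^sup>2 = (sqrt a + sqrt b)\<^sup>2 * (sqrt a - sqrt b)\<^sup>2"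
    using assms by (simp add: power_mult_distrib[symmetric] algebra_simps)
  moreover have "(sqrt a + sqrt b)\<^sup>2 \<ge> a + b"
    using assms by (simp add: power2_sum)
  ultimately show ?thesis
    by (metis mult_right_mono zero_le_power2)
qed

text \<open>An unnormalised form of: the mutual informations between the coordinates of a uniform
  subset and a function of it add up to at most the logarithm of the number of values.\<close>

lemma sum_hellinger_le_ln_card:
  fixes f :: "'a set \<Rightarrow> 'b"
  assumes I: "finite I" and R: "finite R" "f ` Pow I \<subseteq> R"
  shows "(\<Sum>i\<in>I. \<Sum>t\<in>R. (sqrt (card {z \<in> Pow I. i \<in> z \<and> f z = t})
            - sqrt (card {z \<in> Pow I. i \<notin> z \<and> f z = t}))\<^sup>2)
         \<le> 2 * 2 ^ card I * ln (card R)"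
proof -
  define c where "c = (\<lambda>t. card {z \<in> Pow I. f z = t})"
  let ?N = "2 ^ card I :: real"
  have M: "card R > 0"
    using R by (auto simp: card_gt_0_iff)
  \<comment> \<open>The correction \<open>?N / card R - c t\<close> sums to 0 over \<open>R\<close>.
    It comes from linearising the logarithm at the average fibre size \<open>?N / card R\<close>,
    which replaces concavity of entropy.\<close>
  have bound: "(\<Sum>i\<in>I. (sqrt (card {z \<in> Pow I. i \<in> z \<and> f z = t})
            - sqrt (card {z \<in> Pow I. i \<notin> z \<and> f z = t}))\<^sup>2)
      \<le> 2 * (c t * ln (card R) + ?N / card R - c t)" for t
  proof (cases "c t = 0")
    case True
    have "card {z \<in> Pow I. i \<in> z \<and> f z = t} = 0" "card {z \<in> Pow I. i \<notin> z \<and> f z = t} = 0" for i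
      using True I card_mono[of "{z \<in> Pow I. f z = t}" "{z \<in> Pow I. i \<in> z \<and> f z = t}"]
        card_mono[of "{z \<in> Pow I. f z = t}" "{z \<in> Pow I. i \<notin> z \<and> f z = t}"]
      by (auto simp: c_def)
    then show ?thesis
      using True by simp
  next
    case False
    define S where "S = {z \<in> Pow I. f z = t}"
    have S: "S \<subseteq> Pow I" "S \<noteq> {}" "card S = c t"
      using False unfolding S_def c_def by (blast, metis card.empty, blast)
    define a where "a = (\<lambda>i. card {z \<in> S. i \<in> z})"
    define b where "b = (\<lambda>i. card {z \<in> S. i \<notin> z})"
    have ab: "a i + b i = c t" for i
    proof -
      have "S = {z \<in> S. i \<in> z} \<union> {z \<in> S. i \<notin> z}" by auto
      moreover have "finite S"
        using I S by (meson finite_Pow_iff finite_subset)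
      ultimately show ?thesis
        unfolding a_def b_def S(3)[symmetric]
        by (subst card_Un_disjoint[symmetric]) auto
    qed
    have "(\<Sum>i\<in>I. (sqrt (a i) - sqrt (b i))\<^sup>2)
        \<le> (\<Sum>i\<in>I. c t * ((real (a i) - real (b i)) / c t)\<^sup>2)"
    proof (intro sum_mono)
      fix i
      have "real (c t) * (sqrt (a i) - sqrt (b i))\<^sup>2 \<le> (real (a i) - real (b i))\<^sup>2"
        using power2_sqrt_diff_le[of "a i" "b i"] ab[of i] by (simp flip: of_nat_add)
      then have "(sqrt (a i) - sqrt (b i))\<^sup>2 \<le> (real (a i) - real (b i))\<^sup>2 / c t"
        using False by (simp add: le_divide_eq mult.commute)
      then show "(sqrt (a i) - sqrt (b i))\<^sup>2 \<le> c t * ((real (a i) - real (b i)) / c t)\<^sup>2"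
        using False by (simp add: power_divide power2_eq_square[of "real (c t)"])
    qed
    also have "\<dots> = c t * (\<Sum>i\<in>I. ((real (a i) - real (b i)) / c t)\<^sup>2)"
      by (simp add: sum_distrib_left)
    also have "\<dots> \<le> c t * (2 * ln (?N / c t))"
      using level_one_inequality[OF I S(1,2)] unfolding a_def b_def S(3)
      by (intro mult_left_mono) auto
    also have "\<dots> \<le> c t * (2 * (ln (card R) + ?N / (c t * card R) - 1))"
    proof -
      have "ln (?N / c t) = ln (card R * (?N / (c t * card R)))"
        using M by simp
      also have "\<dots> = ln (card R) + ln (?N / (c t * card R))"
        using False M by (intro ln_mult_pos) auto
      also have "ln (?N / (c t * card R)) \<le> ?N / (c t * card R) - 1"
        using False M by (intro ln_le_minus_one) auto
      finally show ?thesis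
        by (intro mult_left_mono) auto
    qed
    also have "\<dots> = 2 * (c t * ln (card R) + ?N / card R - c t)"
      using False by (simp add: algebra_simps)
    finally show ?thesis
      by (simp add: a_def b_def S_def conj_ac)
  qed
  have "(\<Sum>t\<in>R. real (c t)) = ?N"
  proof -
    have "card (Pow I) = card (\<Union>t\<in>R. {z \<in> Pow I. f z = t})"
      using R by (intro arg_cong[where f = card]) auto
    also have "\<dots> = (\<Sum>t\<in>R. c t)"
      unfolding c_def using I R by (intro card_UN_disjoint) auto
    finally have "(\<Sum>t\<in>R. c t) = 2 ^ card I"
      using I by (simp add: card_Pow)
    then show ?thesis
      by (metis of_nat_numeral of_nat_power of_nat_sum)
  qed
  then have "(\<Sum>t\<in>R. 2 * (c t * ln (card R) + ?N / card R - c t)) = 2 * ?N * ln (card R)"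
    using M by (simp add: sum.distrib sum_subtractf sum_distrib_left[symmetric]
        sum_distrib_right[symmetric])
  then show ?thesis
    by (subst sum.swap) (rule order_trans[OF sum_mono[OF bound] eq_refl])
qed

subsection \<open>Rectangular transcripts and set disjointness\<close>

text \<open>For equal total mass, a Hellinger distance depends only on the pointwise products, so
  \<open>prod\<close> trades the pair \<open>00\<close>, \<open>11\<close> for \<open>01\<close>,
  \<open>10\<close>. These are compared through \<open>00\<close>.\<close>

lemma hellinger_cut_and_paste:
  fixes N00 N01 N10 N11 :: "'b \<Rightarrow> real"
  assumes nonneg: "\<And>t. N00 t \<ge> 0" "\<And>t. N01 t \<ge> 0" "\<And>t. N10 t \<ge> 0" "\<And>t. N11 t \<ge> 0"
    and sums: "sum N00 R = K" "sum N01 R = K" "sum N10 R = K" "sum N11 R = K"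
    and prod: "\<And>t. N00 t * N11 t = N01 t * N10 t"
  shows "(\<Sum>t\<in>R. (sqrt (N11 t) - sqrt (N00 t))\<^sup>2)
    \<le> 2 * (\<Sum>t\<in>R. (sqrt (N01 t) - sqrt (N00 t))\<^sup>2) + 2 * (\<Sum>t\<in>R. (sqrt (N10 t) - sqrt (N00 t))\<^sup>2)"
proof -
  have "(\<Sum>t\<in>R. (sqrt (N11 t) - sqrt (N00 t))\<^sup>2) = (\<Sum>t\<in>R. N11 t + N00 t - 2 * sqrt (N00 t * N11 t))"
    using nonneg by (intro sum.cong refl) (simp add: power2_diff real_sqrt_mult)
  also have "\<dots> = (\<Sum>t\<in>R. N01 t + N10 t - 2 * sqrt (N01 t * N10 t))"
    by (simp add: sum.distrib sum_subtractf sums prod)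
  also have "\<dots> = (\<Sum>t\<in>R. (sqrt (N01 t) - sqrt (N10 t))\<^sup>2)"
    using nonneg by (intro sum.cong refl) (simp add: power2_diff real_sqrt_mult)
  also have "\<dots> \<le> (\<Sum>t\<in>R. 2 * (sqrt (N01 t) - sqrt (N00 t))\<^sup>2 + 2 * (sqrt (N10 t) - sqrt (N00 t))\<^sup>2)"
  proof (intro sum_mono)
    have "(b - c)\<^sup>2 \<le> 2 * (b - a)\<^sup>2 + 2 * (c - a)\<^sup>2" for a b c :: real
      using zero_le_power2[of "b + c - 2 * a"] by (simp add: power2_eq_square algebra_simps)
    then show "(sqrt (N01 t) - sqrt (N10 t))\<^sup>2
        \<le> 2 * (sqrt (N01 t) - sqrt (N00 t))\<^sup>2 + 2 * (sqrt (N10 t) - sqrt (N00 t))\<^sup>2" for t .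
  qed
  finally show ?thesis
    by (simp add: sum.distrib sum_distrib_left)
qed

text \<open>Weighted AM-GM. The weight 1/12 of the mass term amounts to 1/6 per set \<open>z\<close>
  in \<open>protocol_advantage_le\<close>, half of the advantage 1/3 of a correct protocol.\<close>

lemma abs_diff_le_hellinger:
  fixes a b :: real
  assumes "a \<ge> 0" "b \<ge> 0"
  shows "\<bar>a - b\<bar> \<le> 6 * (sqrt a - sqrt b)\<^sup>2 + (a + b) / 12"
proof -
  define u v where "u = \<bar>sqrt a - sqrt b\<bar>" and "v = sqrt a + sqrt b"
  have "a - b = (sqrt a - sqrt b) * v"
    using assms by (simp add: v_def algebra_simps)
  then have "\<bar>a - b\<bar> = u * v"
    using assms by (simp add: abs_mult u_def v_def)
  also have "\<dots> \<le> 6 * u\<^sup>2 + v\<^sup>2 / 24"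
    using zero_le_power2[of "12 * u - v"] by (simp add: power2_eq_square algebra_simps)
  also have "v\<^sup>2 \<le> 2 * (a + b)"
    using assms zero_le_power2[of "sqrt a - sqrt b"]
    by (simp add: v_def power2_sum power2_diff)
  finally show ?thesis
    by (simp add: u_def field_simps)
qed

text \<open>The parts \<open>z - D\<close> and \<open>z \<inter> D\<close> vary independently, and
  by \<open>cross\<close> the transcript is \<open>t\<close> exactly when each part is compatible
  with \<open>t\<close>. This supplies the product identity for cutting and pasting.\<close>

lemma card_transcript_eq_product:
  assumes cross: "\<And>x y x' y'. tau x y = t \<Longrightarrow> tau x' y' = t \<Longrightarrow> tau x y' = t"
    and D: "D \<subseteq> J"
  shows "card {z \<in> Pow J. tau (p (z - D)) (q (z \<inter> D)) = t}
    = card {u \<in> Pow (J - D). \<exists>y. tau (p u) y = t} * card {v \<in> Pow D. \<exists>x. tau x (q v) = t}"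
proof -
  define A where "A = {u \<in> Pow (J - D). \<exists>y. tau (p u) y = t}"
  define B where "B = {v \<in> Pow D. \<exists>x. tau x (q v) = t}"
  define C where "C = {z \<in> Pow J. tau (p (z - D)) (q (z \<inter> D)) = t}"
  have "bij_betw (\<lambda>z. (z - D, z \<inter> D)) C (A \<times> B)"
  proof (rule bij_betw_byWitness[where f' = "\<lambda>(u, v). u \<union> v"])
    show "(\<lambda>z. (z - D, z \<inter> D)) ` C \<subseteq> A \<times> B"
      unfolding A_def B_def C_def by blast
    show "(\<lambda>(u, v). u \<union> v) ` (A \<times> B) \<subseteq> C"
    proof (rule image_subsetI)
      fix w assume "w \<in> A \<times> B"
      then obtain u v x y where w: "w = (u, v)" and uv: "u \<subseteq> J - D" "v \<subseteq> D"
        and "tau (p u) y = t" "tau x (q v) = t"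
        unfolding A_def B_def by blast
      then have "tau (p u) (q v) = t"
        using cross by blast
      moreover have "(u \<union> v) - D = u" "(u \<union> v) \<inter> D = v" "u \<union> v \<subseteq> J"
        using uv D by auto
      ultimately show "(case w of (u, v) \<Rightarrow> u \<union> v) \<in> C"
        by (simp add: w C_def)
    qed
  qed (auto simp: A_def B_def)
  then show ?thesis
    unfolding A_def[symmetric] B_def[symmetric] C_def[symmetric]
    by (simp add: bij_betw_same_card card_cartesian_product)
qed

lemma sum_Pow_remove:
  fixes f :: "'a set \<Rightarrow> real"
  assumes "finite I" "i \<in> I"
  shows "(\<Sum>D\<in>Pow I. f D) = (\<Sum>D\<in>Pow (I - {i}). f D + f (insert i D))"
proof -
  define J where "J = I - {i}"
  have J: "I = insert i J" "i \<notin> J" "finite J"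
    using assms by (auto simp: J_def)
  have "inj_on (insert i) (Pow J)"
    using J by (intro inj_onI) (metis PowD insert_ident subsetD)
  then show ?thesis
    unfolding J_def[symmetric] J(1) Pow_insert using J
    by (subst sum.union_disjoint) (auto simp: sum.reindex sum.distrib)
qed

text \<open>\<open>cross\<close> says that each transcript \<open>tau x y\<close> corresponds to a combinatorial rectangle. A set \<open>D\<close> assigns every coordinate
  to one of the players: \<open>z \<inter> D\<close> and \<open>z - D\<close> are disjoint, and become uniquely intersecting
  by adding \<open>i\<close> to both.\<close>

lemma protocol_advantage_le:
  fixes tau :: "'a set \<Rightarrow> 'a set \<Rightarrow> 'b" and g :: "'b \<Rightarrow> real"
  assumes I: "finite I" and R: "finite R" "\<And>x y. tau x y \<in> R"
    and cross: "\<And>t x y x' y'. tau x y = t \<Longrightarrow> tau x' y' = t \<Longrightarrow> tau x y' = t"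
    and g: "\<And>t. 0 \<le> g t" "\<And>t. g t \<le> 1"
  shows "(\<Sum>i\<in>I. \<Sum>D\<in>Pow (I - {i}). \<Sum>z\<in>Pow (I - {i}).
            g (tau (insert i (z - D)) (insert i (z \<inter> D))) - g (tau (z - D) (z \<inter> D)))
         \<le> 24 * 4 ^ card I * ln (card R) + card I * 4 ^ card I / 24"
proof -
  define f where "f = (\<lambda>D z. tau (z - D) (z \<inter> D))"
  define G where "G = (\<lambda>i D. \<Sum>t\<in>R. (sqrt (card {z \<in> Pow I. i \<in> z \<and> f D z = t})
            - sqrt (card {z \<in> Pow I. i \<notin> z \<and> f D z = t}))\<^sup>2)"
  have step: "(\<Sum>z\<in>Pow (I - {i}).
            g (tau (insert i (z - D)) (insert i (z \<inter> D))) - g (tau (z - D) (z \<inter> D)))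
        \<le> 12 * (G i D + G i (insert i D)) + 2 ^ card I / 12"
    if i: "i \<in> I" and D: "D \<in> Pow (I - {i})" for i D
  proof -
    define J where "J = I - {i}"
    have J: "finite J" "i \<notin> J" "D \<subseteq> J" "I = insert i J"
      using I i D by (auto simp: J_def)
    \<comment> \<open>With \<open>p\<close> and \<open>q\<close> equal to \<open>id\<close> or
      \<open>insert i\<close>, these are the transcript counts for the four choices of bit
      \<open>i\<close> in the two inputs.\<close>
    define N where "N = (\<lambda>p q t. real (card {z \<in> Pow J. tau (p (z - D)) (q (z \<inter> D)) = t}))"
    have N_prod: "N p q t * N p' q' t = N p q' t * N p' q t" for p q p' q' t
    proof -
      have *: "card {z \<in> Pow J. tau (p (z - D)) (q (z \<inter> D)) = t}
        = card {u \<in> Pow (J - D). \<exists>y. tau (p u) y = t} * card {v \<in> Pow D. \<exists>x. tau x (q v) = t}" for p q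
        by (rule card_transcript_eq_product[OF _ J(3)]) (rule cross)
      show ?thesis
        unfolding N_def * by simp
    qed
    have sum_N: "(\<Sum>z\<in>Pow J. h (tau (p (z - D)) (q (z \<inter> D)))) = (\<Sum>t\<in>R. h t * N p q t)"
      for p q and h :: "'b \<Rightarrow> real"
    proof -
      have "(\<Sum>z\<in>Pow J. h (tau (p (z - D)) (q (z \<inter> D))))
        = (\<Sum>t\<in>R. \<Sum>z\<in>{z \<in> Pow J. tau (p (z - D)) (q (z \<inter> D)) = t}. h (tau (p (z - D)) (q (z \<inter> D))))"
        using J R by (intro sum.group[symmetric]) auto
      also have "\<dots> = (\<Sum>t\<in>R. h t * N p q t)"
        unfolding N_def by (intro sum.cong refl) simp
      finally show ?thesis .
    qed
    define K :: real where "K = 2 ^ card J"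
    have K: "sum (N p q) R = K" for p q
      using sum_N[of "\<lambda>_. 1" p q] J by (simp add: K_def card_Pow)
    have K2: "2 * K = 2 ^ card I"
      using J by (simp add: K_def)
    have cardI: "card {z \<in> Pow I. i \<in> z \<and> f E z = t} = card {z \<in> Pow J. f E (insert i z) = t}"
      "card {z \<in> Pow I. i \<notin> z \<and> f E z = t} = card {z \<in> Pow J. f E z = t}" for E t
    proof -
      have "bij_betw (insert i) {z \<in> Pow J. f E (insert i z) = t} {z \<in> Pow I. i \<in> z \<and> f E z = t}"
        using J by (intro bij_betw_byWitness[where f' = "\<lambda>z. z - {i}"]) (auto simp: insert_absorb)
      then show "card {z \<in> Pow I. i \<in> z \<and> f E z = t} = card {z \<in> Pow J. f E (insert i z) = t}"
        by (simp add: bij_betw_same_card)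
      show "card {z \<in> Pow I. i \<notin> z \<and> f E z = t} = card {z \<in> Pow J. f E z = t}"
        using J by (intro arg_cong[where f = card]) auto
    qed
    \<comment> \<open>Under \<open>D\<close> the owner of \<open>i\<close> is the first player,
      under \<open>insert i D\<close> the second; flipping \<open>i\<close> in \<open>z\<close>
      changes only the owner's input.\<close>
    have f_eq: "f D (insert i z) = tau (insert i (z - D)) (z \<inter> D)"
      "f (insert i D) (insert i z) = tau (z - D) (insert i (z \<inter> D))"
      "f (insert i D) z = tau (z - D) (z \<inter> D)" if "z \<in> Pow J" for z
    proof -
      have "insert i z - D = insert i (z - D)" "insert i z \<inter> D = z \<inter> D"
        "insert i z - insert i D = z - D" "insert i z \<inter> insert i D = insert i (z \<inter> D)"
        "z - insert i D = z - D" "z \<inter> insert i D = z \<inter> D"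
        using that J by auto
      then show "f D (insert i z) = tau (insert i (z - D)) (z \<inter> D)"
        "f (insert i D) (insert i z) = tau (z - D) (insert i (z \<inter> D))"
        "f (insert i D) z = tau (z - D) (z \<inter> D)"
        by (simp_all add: f_def)
    qed
    have G1: "G i D = (\<Sum>t\<in>R. (sqrt (N (insert i) id t) - sqrt (N id id t))\<^sup>2)"
      unfolding G_def N_def cardI using f_eq(1) by (simp add: f_def cong: conj_cong)
    have G2: "G i (insert i D) = (\<Sum>t\<in>R. (sqrt (N id (insert i) t) - sqrt (N id id t))\<^sup>2)"
      unfolding G_def N_def cardI using f_eq(2,3) by (simp cong: conj_cong)
    have nonneg: "N p q t \<ge> 0" for p q t
      by (simp add: N_def)
    have "(\<Sum>z\<in>Pow J. g (tau (insert i (z - D)) (insert i (z \<inter> D))) - g (tau (z - D) (z \<inter> D)))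
       = (\<Sum>t\<in>R. g t * (N (insert i) (insert i) t - N id id t))"
      using sum_N[of g "insert i" "insert i"] sum_N[of g id id]
      by (simp add: sum_subtractf right_diff_distrib)
    also have "\<dots> \<le> (\<Sum>t\<in>R. 6 * (sqrt (N (insert i) (insert i) t) - sqrt (N id id t))\<^sup>2
        + (N (insert i) (insert i) t + N id id t) / 12)"
    proof (intro sum_mono)
      fix t
      have "g t * d \<le> \<bar>d\<bar>" for d
        using mult_left_mono[OF abs_ge_self g(1), of t d] mult_right_mono[OF g(2) abs_ge_zero, of t d]
        by linarith
      from this[of "N (insert i) (insert i) t - N id id t"]
      show "g t * (N (insert i) (insert i) t - N id id t)
         \<le> 6 * (sqrt (N (insert i) (insert i) t) - sqrt (N id id t))\<^sup>2
           + (N (insert i) (insert i) t + N id id t) / 12"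
        using abs_diff_le_hellinger[OF nonneg nonneg, of "insert i" "insert i" t id id t] by linarith
    qed
    also have "\<dots> = 6 * (\<Sum>t\<in>R. (sqrt (N (insert i) (insert i) t) - sqrt (N id id t))\<^sup>2) + K / 6"
      by (simp add: sum.distrib sum_distrib_left[symmetric] sum_divide_distrib[symmetric] K)
    also have "\<dots> \<le> 6 * (2 * G i (insert i D) + 2 * G i D) + K / 6"
      unfolding G1 G2
      by (intro add_right_mono mult_left_mono hellinger_cut_and_paste[OF nonneg nonneg nonneg nonneg K K K K])
         (auto simp: N_prod)
    finally show ?thesis
      using K2 by (simp add: J_def algebra_simps)
  qed
  have "(\<Sum>i\<in>I. \<Sum>D\<in>Pow (I - {i}). \<Sum>z\<in>Pow (I - {i}).
            g (tau (insert i (z - D)) (insert i (z \<inter> D))) - g (tau (z - D) (z \<inter> D)))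
      \<le> (\<Sum>i\<in>I. \<Sum>D\<in>Pow (I - {i}). 12 * (G i D + G i (insert i D)) + 2 ^ card I / 12)"
    by (intro sum_mono step)
  also have "\<dots> = (\<Sum>i\<in>I. 12 * (\<Sum>D\<in>Pow I. G i D) + 4 ^ card I / 24)"
  proof (intro sum.cong refl)
    fix i assume i: "i \<in> I"
    have "card (Pow (I - {i})) * (2 ^ card I / 12 :: real) = 4 ^ card I / 24"
      using I i by (cases "card I") (auto simp: card_Pow power_mult_distrib[symmetric])
    then show "(\<Sum>D\<in>Pow (I - {i}). 12 * (G i D + G i (insert i D)) + 2 ^ card I / 12)
        = 12 * (\<Sum>D\<in>Pow I. G i D) + 4 ^ card I / 24"
      by (simp add: sum_Pow_remove[OF I i] sum.distrib sum_distrib_left[symmetric])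
  qed
  also have "\<dots> = 12 * (\<Sum>D\<in>Pow I. \<Sum>i\<in>I. G i D) + card I * 4 ^ card I / 24"
    by (simp add: sum.distrib sum_distrib_left[symmetric] sum.swap[of _ "Pow I" I])
  \<comment> \<open>For fixed \<open>D\<close> the transcript is a function of the uniform set
    \<open>z\<close>, so the information bound applies.\<close>
  also have "(\<Sum>D\<in>Pow I. \<Sum>i\<in>I. G i D) \<le> (\<Sum>D\<in>Pow I. 2 * 2 ^ card I * ln (card R))"
    unfolding G_def by (intro sum_mono sum_hellinger_le_ln_card I R) (auto simp: f_def R)
  also have "\<dots> = 2 * 4 ^ card I * ln (card R)"
    using I by (simp add: card_Pow power_mult_distrib[symmetric])
  finally show ?thesis
    by simp
qed

subsection \<open>From streaming algorithms to transcripts\<close>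

text \<open>The memory at the two handovers of each pass, latest first. The initial memory is
  determined by the seed, so \<open>2 * k\<close> states are recorded.\<close>

primrec transcript :: "stream_alg \<Rightarrow> nat \<Rightarrow> nat set list \<Rightarrow> nat set list \<Rightarrow> nat \<Rightarrow> nat list" where
  "transcript A r xs ys 0 = []"
| "transcript A r xs ys (Suc k) =
     (let q = run_pass A r k xs (run_alg A k r (xs @ ys))
      in run_pass A r k ys q # q # transcript A r xs ys k)"

lemma run_alg_Suc: "run_alg A (Suc k) r xs = run_pass A r k xs (run_alg A k r xs)"
  by (simp add: run_alg_def)

lemma run_pass_append: "run_pass A r i (xs @ ys) q = run_pass A r i ys (run_pass A r i xs q)"
  by (simp add: run_pass_def)

text \<open>The answer can thus be read off the transcript; the appended \<open>st_init A r\<close>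
  is the value for \<open>k = 0\<close>.\<close>

lemma run_alg_eq_hd_transcript:
  "run_alg A k r (xs @ ys) = hd (transcript A r xs ys k @ [st_init A r])"
  by (cases k) (simp_all add: run_alg_Suc run_pass_append Let_def, simp add: run_alg_def)

text \<open>Equal earlier passes fix the memory entering the current pass. From there the first half
  depends only on \<open>xs\<close>, and the second only on \<open>ys\<close> and the state handed
  over.\<close>

lemma transcript_cross:
  "transcript A r xs ys k = transcript A r xs' ys' k \<Longrightarrow> transcript A r xs ys' k = transcript A r xs ys k"
proof (induction k)
  case (Suc k)
  have *: "transcript A r xs ys k = transcript A r xs' ys' k"
    using Suc.prems by (simp add: Let_def)
  note eq = Suc.IH[OF *]
  have "run_alg A k r (xs @ ys') = run_alg A k r (xs @ ys)"
    by (simp add: run_alg_eq_hd_transcript eq)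
  then show ?case
    using Suc.prems eq unfolding transcript.simps Let_def by (metis list.inject)
qed simp

lemma run_pass_less:
  assumes "space_bounded A s" "q < 2 ^ s"
  shows "run_pass A r i xs q < 2 ^ s"
  using assms(2) unfolding run_pass_def
  by (induction xs arbitrary: q) (use assms(1) in \<open>auto simp: space_bounded_def\<close>)

lemma run_alg_less:
  assumes "space_bounded A s"
  shows "run_alg A k r xs < 2 ^ s"
proof (induction k)
  case 0
  then show ?case
    using assms by (simp add: run_alg_def space_bounded_def)
qed (simp add: run_alg_Suc run_pass_less[OF assms])

lemma transcript_in_lists:
  assumes "space_bounded A s"
  shows "transcript A r xs ys k \<in> {l. set l \<subseteq> {..<2 ^ s} \<and> length l = 2 * k}"
  by (induction k) (simp_all add: Let_def run_pass_less run_alg_less assms)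

subsection \<open>The hard graphs\<close>

text \<open>The vertices are \<open>n\<close> element vertices \<open>0, \<dots>, n - 1\<close>, the vertices \<open>n, \<dots>, n + t - 1\<close>, which
  the first player joins to the elements of her set \<open>x\<close>, and \<open>2 n, \<dots>, 3 n - 1\<close>, the first \<open>t\<close> of which
  the second player joins to the elements of his set \<open>y\<close>. All \<open>n\<close> vertices of the last block
  take part in the fixed complete bipartite graph, so that there are at least \<open>n t\<close> edges.\<close>

definition pairs_first :: "nat \<Rightarrow> nat \<Rightarrow> nat set \<Rightarrow> (nat \<times> nat) set" where
  "pairs_first n t x = x \<times> {n..<n + t} \<union> {n..<n + t} \<times> {2 * n..<3 * n}"

definition pairs_second :: "nat \<Rightarrow> nat \<Rightarrow> nat set \<Rightarrow> (nat \<times> nat) set" where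
  "pairs_second n t y = y \<times> {2 * n..<2 * n + t}"

definition edge :: "nat \<times> nat \<Rightarrow> nat set" where
  "edge = (\<lambda>(p, q). {p, q})"

definition disj_graph :: "nat \<Rightarrow> nat \<Rightarrow> nat set \<Rightarrow> nat set \<Rightarrow> nat set set" where
  "disj_graph n t x y = edge ` (pairs_first n t x \<union> pairs_second n t y)"

lemma inj_on_edge: "inj_on edge {(p, q). p < q}"
  by (auto simp: inj_on_def edge_def doubleton_eq_iff)

context
  fixes n t :: nat and x y :: "nat set"
  assumes t: "1 \<le> t" "t \<le> n" and xy: "x \<subseteq> {..<n}" "y \<subseteq> {..<n}"
begin

lemma pairs_less: "pairs_first n t x \<union> pairs_second n t y \<subseteq> {(p, q). p < q}"
  using t xy by (auto simp: pairs_first_def pairs_second_def)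

lemma finite_pairs: "finite (pairs_first n t x)" "finite (pairs_second n t y)"
  using xy by (auto simp: pairs_first_def pairs_second_def intro: finite_subset)

lemma edges_disjoint: "edge ` pairs_first n t x \<inter> edge ` pairs_second n t y = {}"
proof -
  have "pairs_first n t x \<inter> pairs_second n t y = {}"
    using t xy by (auto simp: pairs_first_def pairs_second_def)
  then show ?thesis
    using inj_on_image_Int[OF inj_on_edge, of "pairs_first n t x" "pairs_second n t y"] pairs_less by auto
qed

lemma graph_on_disj_graph: "graph_on (3 * n) (disj_graph n t x y)"
  using t xy by (auto simp: graph_on_def disj_graph_def edge_def pairs_first_def pairs_second_def card_insert_if)

lemma card_disj_graph:
  "n * t \<le> card (disj_graph n t x y)" "card (disj_graph n t x y) \<le> 3 * n * t"
proof -
  have eq: "card (disj_graph n t x y) = card (pairs_first n t x \<union> pairs_second n t y)"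
    unfolding disj_graph_def using inj_on_subset[OF inj_on_edge pairs_less] by (rule card_image)
  have "card ({n..<n + t} \<times> {2 * n..<3 * n}) \<le> card (pairs_first n t x \<union> pairs_second n t y)"
    using finite_pairs by (intro card_mono) (auto simp: pairs_first_def)
  then show "n * t \<le> card (disj_graph n t x y)"
    by (simp add: eq card_cartesian_product mult.commute)
  have "card x \<le> n" "card y \<le> n"
    using xy card_mono[of "{..<n}"] by auto
  have "card (pairs_first n t x \<union> pairs_second n t y)
      \<le> card (x \<times> {n..<n + t}) + card ({n..<n + t} \<times> {2 * n..<3 * n}) + card (pairs_second n t y)"
    unfolding pairs_first_def by (meson add_le_mono card_Un_le le_refl order_trans)
  also have "\<dots> \<le> n * t + n * t + n * t"
    using \<open>card x \<le> n\<close> \<open>card y \<le> n\<close>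
    by (intro add_mono) (auto simp: pairs_second_def card_cartesian_product)
  finally show "card (disj_graph n t x y) \<le> 3 * n * t"
    by (simp add: eq)
qed

section \<open>Triangles of the hard graphs\<close>

lemma edge_in_disj_graph_iff:
  "{p, q} \<in> disj_graph n t x y \<longleftrightarrow>
     (p, q) \<in> pairs_first n t x \<union> pairs_second n t y \<or> (q, p) \<in> pairs_first n t x \<union> pairs_second n t y"
  by (auto simp: disj_graph_def edge_def doubleton_eq_iff image_iff)

lemma triangles_disj_graph_empty:
  assumes "x \<inter> y = {}"
  shows "triangles (disj_graph n t x y) = {}"
proof (rule ccontr)
  assume "triangles (disj_graph n t x y) \<noteq> {}"
  then obtain S where S: "card S = 3" "\<And>p q. p \<in> S \<Longrightarrow> q \<in> S \<Longrightarrow> p \<noteq> q \<Longrightarrow> {p, q} \<in> disj_graph n t x y"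
    by (auto simp: triangles_def)
  obtain a b c where abc: "S = {a, b, c}" "a \<noteq> b" "b \<noteq> c" "a \<noteq> c"
    using S(1) by (auto simp: card_3_iff)
  define P where "P = pairs_first n t x \<union> pairs_second n t y"
  \<comment> \<open>Such \<open>p < q < r\<close> must lie in the three blocks in turn, so
    \<open>(p, q)\<close> puts \<open>p\<close> into \<open>x\<close> and \<open>(p, r)\<close> puts
    it into \<open>y\<close>.\<close>
  have no: False if "(p, q) \<in> P" "(q, r) \<in> P" "(p, r) \<in> P" for p q r
    using that assms t xy by (auto simp: P_def pairs_first_def pairs_second_def)
  have less: "p < q" if "(p, q) \<in> P" for p q
    using that pairs_less by (auto simp: P_def)
  have "(a, b) \<in> P \<or> (b, a) \<in> P" "(b, c) \<in> P \<or> (c, b) \<in> P" "(a, c) \<in> P \<or> (c, a) \<in> P"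
    using S(2) abc by (auto simp: edge_in_disj_graph_iff P_def)
  \<comment> \<open>An orientation of the three edges is either cyclic, against \<open>less\<close>,
    or transitive, against \<open>no\<close>.\<close>
  then show False
    using no less by (meson less_trans less_asym)
qed

lemma card_triangles_disj_graph_ge:
  assumes "i \<in> x" "i \<in> y"
  shows "t\<^sup>2 \<le> card (triangles (disj_graph n t x y))"
proof -
  define h where "h = (\<lambda>(j, l). {i, n + j, 2 * n + l})"
  have i: "i < n"
    using assms xy by auto
  have "inj_on h ({..<t} \<times> {..<t})"
  proof (rule inj_onI)
    fix u v
    assume uv: "u \<in> {..<t} \<times> {..<t}" "v \<in> {..<t} \<times> {..<t}" "h u = h v"
    obtain j l j' l' where jl: "u = (j, l)" "v = (j', l')"
      by (metis surj_pair)
    have "n + j \<in> {i, n + j', 2 * n + l'}" "2 * n + l \<in> {i, n + j', 2 * n + l'}"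
      using uv jl by (auto simp: h_def)
    then show "u = v"
      using uv jl i t by auto
  qed
  then have "t\<^sup>2 = card (h ` ({..<t} \<times> {..<t}))"
    by (simp add: card_image card_cartesian_product power2_eq_square)
  also have "\<dots> \<le> card (triangles (disj_graph n t x y))"
  proof (rule card_mono)
    show "finite (triangles (disj_graph n t x y))"
    proof (rule finite_subset)
      show "triangles (disj_graph n t x y) \<subseteq> Pow {..<3 * n}"
      proof (intro subsetI PowI)
        fix S p assume S: "S \<in> triangles (disj_graph n t x y)" "p \<in> S"
        have "S \<noteq> {p}"
          using S by (auto simp: triangles_def)
        then obtain q where "q \<in> S" "q \<noteq> p"
          using S by blast
        then have "{p, q} \<in> disj_graph n t x y"
          using S by (auto simp: triangles_def)
        then show "p \<in> {..<3 * n}"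
          using graph_on_disj_graph by (auto simp: graph_on_def)
      qed
    qed simp
    show "h ` ({..<t} \<times> {..<t}) \<subseteq> triangles (disj_graph n t x y)"
    proof (rule image_subsetI)
      fix u assume "u \<in> {..<t} \<times> {..<t}"
      then obtain j l where u: "u = (j, l)" "j < t" "l < t"
        by auto
      have E: "{i, n + j} \<in> disj_graph n t x y" "{i, 2 * n + l} \<in> disj_graph n t x y"
        "{n + j, 2 * n + l} \<in> disj_graph n t x y"
        unfolding edge_in_disj_graph_iff pairs_first_def pairs_second_def using u assms t by auto
      have "card (h u) = 3"
        using u i t by (simp add: h_def card_insert_if)
      then show "h u \<in> triangles (disj_graph n t x y)"
        using E by (auto simp: triangles_def h_def u insert_commute)
    qed
  qed
  finally show ?thesis .
qed

end

definition disj_family :: "nat \<Rightarrow> nat \<Rightarrow> nat set set set" where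
  "disj_family n t = {disj_graph n t x y | x y. x \<subseteq> {..<n} \<and> y \<subseteq> {..<n}}"

lemma disj_family:
  assumes "1 \<le> t" "t \<le> n" "E \<in> disj_family n t"
  shows "graph_on (3 * n) E" "n * t \<le> card E" "card E \<le> 3 * n * t"
    "card (triangles E) = 0 \<or> t\<^sup>2 \<le> card (triangles E)"
proof -
  obtain x y where E: "E = disj_graph n t x y" and xy: "x \<subseteq> {..<n}" "y \<subseteq> {..<n}"
    using assms(3) by (auto simp: disj_family_def)
  show "graph_on (3 * n) E" "n * t \<le> card E" "card E \<le> 3 * n * t"
    unfolding E using graph_on_disj_graph[OF assms(1,2) xy] card_disj_graph[OF assms(1,2) xy] by auto
  show "card (triangles E) = 0 \<or> t\<^sup>2 \<le> card (triangles E)"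
  proof (cases "x \<inter> y = {}")
    case True
    then show ?thesis
      by (simp add: E triangles_disj_graph_empty[OF assms(1,2) xy])
  next
    case False
    then show ?thesis
      using card_triangles_disj_graph_ge[OF assms(1,2) xy] by (auto simp: E)
  qed
qed

subsection \<open>Space lower bound\<close>

text \<open>The averaging step of Yao's principle: a bound valid for every seed survives the
  expectation over seeds.\<close>

lemma sum_prob_le:
  fixes p :: "'r pmf"
  assumes J: "finite J" and le: "\<And>r. (\<Sum>j\<in>J. indicator (S j) r + indicator (T j) r) \<le> (K :: real)"
  shows "(\<Sum>j\<in>J. measure_pmf.prob p (S j) + measure_pmf.prob p (T j)) \<le> K"
proof -
  have int: "integrable (measure_pmf p) (indicator X :: 'r \<Rightarrow> real)" for X
    by (rule measure_pmf.integrable_const_bound[where B = 1]) auto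
  have "(\<Sum>j\<in>J. measure_pmf.prob p (S j) + measure_pmf.prob p (T j))
      = measure_pmf.expectation p (\<lambda>r. \<Sum>j\<in>J. indicator (S j) r + indicator (T j) r)"
    using int by (simp add: Bochner_Integration.integral_sum Bochner_Integration.integral_add)
  also have "\<dots> \<le> K"
    using int le by (intro measure_pmf.integral_le_const) auto
  finally show ?thesis .
qed

text \<open>Each triple \<open>(i, D, z)\<close> pairs an intersecting input with a disjoint one.
  Correctness yields success probabilities of at least 4/3 per triple, whereas a fixed seed yields 1
  plus its advantage, whose total \<open>protocol_advantage_le\<close> bounds.\<close>

lemma disj_family_space_bound:
  assumes t: "1 \<le> t" "t \<le> n"
    and A: "space_bounded A s" "solves_Dist A k (t\<^sup>2) (disj_family n t)"
  shows "real n \<le> 1152 * (real k * real s)"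
proof -
  define I where "I = {..<n}"
  \<comment> \<open>Every edge order is allowed, so the first player's edges may come first;
    \<open>l1\<close> depends on \<open>x\<close> alone and \<open>l2\<close> on \<open>y\<close>
    alone, as a two-player protocol requires.\<close>
  define l1 where "l1 = (\<lambda>x. SOME l. set l = edge ` pairs_first n t x \<and> distinct l)"
  define l2 where "l2 = (\<lambda>y. SOME l. set l = edge ` pairs_second n t y \<and> distinct l)"
  define ok where "ok = (\<lambda>b x y. {r. st_out A r (run_alg A k r (l1 x @ l2 y)) = b})"
  have prob: "measure_pmf.prob (seed A) (ok (x \<inter> y \<noteq> {}) x y) \<ge> 2/3"
    if xy: "x \<subseteq> I" "y \<subseteq> I" for x y
  proof -
    note xy' = xy[unfolded I_def]
    have "set (l1 x) = edge ` pairs_first n t x \<and> distinct (l1 x)"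
      unfolding l1_def
      by (rule someI_ex[OF finite_distinct_list]) (simp add: finite_pairs(1)[OF t xy'])
    moreover have "set (l2 y) = edge ` pairs_second n t y \<and> distinct (l2 y)"
      unfolding l2_def
      by (rule someI_ex[OF finite_distinct_list]) (simp add: finite_pairs(2)[OF t xy'])
    ultimately have "is_stream_of (l1 x @ l2 y) (disj_graph n t x y)"
      using edges_disjoint[OF t xy'] by (simp add: is_stream_of_def disj_graph_def image_Un)
    moreover have "disj_graph n t x y \<in> disj_family n t"
      using xy' by (auto simp: disj_family_def)
    ultimately have "measure_pmf.prob (seed A)
        {r. st_out A r (run_alg A k r (l1 x @ l2 y)) = (t\<^sup>2 \<le> card (triangles (disj_graph n t x y)))} \<ge> 2/3"
      using A(2) unfolding solves_Dist_def by blast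
    moreover have "(t\<^sup>2 \<le> card (triangles (disj_graph n t x y))) = (x \<inter> y \<noteq> {})"
    proof (cases "x \<inter> y = {}")
      case True
      then show ?thesis
        using t by (simp add: triangles_disj_graph_empty[OF t xy'])
    next
      case False
      then show ?thesis
        using card_triangles_disj_graph_ge[OF t xy'] by auto
    qed
    ultimately show ?thesis
      by (simp only: ok_def)
  qed
  define R where "R = {l :: nat list. set l \<subseteq> {..<2 ^ s} \<and> length l = 2 * k}"
  have R: "finite R" "card R = (2 ^ s) ^ (2 * k)"
    unfolding R_def by (simp_all add: finite_lists_length_eq card_lists_length_eq)
  define J where "J = (SIGMA i:I. Pow (I - {i}) \<times> Pow (I - {i}))"
  have "finite J"
    by (auto simp: J_def I_def)
  have cardJ: "4 * real (card J) = n * 4 ^ n"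
  proof -
    have "card J = n * (2 ^ (n - 1) * 2 ^ (n - 1))"
      by (simp add: J_def I_def card_cartesian_product card_Pow)
    then show ?thesis
      by (cases n) (simp_all flip: power_mult_distrib)
  qed
  define ok_int where "ok_int = (\<lambda>(i, D, z). ok True (insert i (z - D)) (insert i (z \<inter> D)))"
  define ok_disj where "ok_disj = (\<lambda>(i :: nat, D, z). ok False (z - D) (z \<inter> D))"
  define B where "B = 24 * 4 ^ n * ln (real (card R)) + n * 4 ^ n / 24"
  have "(\<Sum>j\<in>J. indicator (ok_int j) r + indicator (ok_disj j) r) \<le> card J + B" for r
  proof -
    define g where "g = (\<lambda>l. of_bool (st_out A r (hd (l @ [st_init A r]))) :: real)"
    define tau where "tau = (\<lambda>x y. transcript A r (l1 x) (l2 y) k)"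
    have g_tau: "g (tau x y) = of_bool (st_out A r (run_alg A k r (l1 x @ l2 y)))" for x y
      by (simp add: g_def tau_def run_alg_eq_hd_transcript)
    define h where "h = (\<lambda>i D z. g (tau (insert i (z - D)) (insert i (z \<inter> D))) - g (tau (z - D) (z \<inter> D)))"
    \<comment> \<open>A correct True counts \<open>g\<close> and a correct False counts
      \<open>1 - g\<close>, hence 1 plus the difference \<open>h\<close>.\<close>
    have "(\<Sum>j\<in>J. indicator (ok_int j) r + indicator (ok_disj j) r) = (\<Sum>(i, D, z)\<in>J. 1 + h i D z)"
      by (intro sum.cong refl)
         (simp add: h_def g_tau ok_int_def ok_disj_def ok_def indicator_def split: prod.split)
    also have "\<dots> = card J + (\<Sum>(i, D, z)\<in>J. h i D z)"
      by (simp add: case_prod_unfold sum.distrib)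
    also have "(\<Sum>(i, D, z)\<in>J. h i D z)
        = (\<Sum>i\<in>I. \<Sum>(D, z)\<in>Pow (I - {i}) \<times> Pow (I - {i}). h i D z)"
      unfolding J_def by (rule sum.Sigma[symmetric]) (auto simp: I_def)
    also have "\<dots> = (\<Sum>i\<in>I. \<Sum>D\<in>Pow (I - {i}). \<Sum>z\<in>Pow (I - {i}). h i D z)"
      by (simp only: sum.cartesian_product)
    also have "card J + \<dots> \<le> card J + B"
    proof -
      have tau_R: "tau x y \<in> R" for x y
        unfolding tau_def R_def by (rule transcript_in_lists[OF A(1)])
      have cross: "tau x y' = u" if "tau x y = u" "tau x' y' = u" for u x y x' y'
        using that transcript_cross[of A r "l1 x" "l2 y" k "l1 x'" "l2 y'"] by (simp add: tau_def)
      have I: "finite I" "n = card I"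
        by (simp_all add: I_def)
      have g: "0 \<le> g u" "g u \<le> 1" for u
        by (simp_all add: g_def)
      show ?thesis
        unfolding B_def h_def I(2)
        by (rule add_left_mono, rule protocol_advantage_le)
           (rule I, rule R, rule tau_R, rule cross, assumption+, rule g, rule g)
    qed
    finally show ?thesis .
  qed
  from sum_prob_le[OF \<open>finite J\<close> this, of "seed A"]
  have "(\<Sum>j\<in>J. measure_pmf.prob (seed A) (ok_int j) + measure_pmf.prob (seed A) (ok_disj j)) \<le> card J + B" .
  moreover have "(\<Sum>j\<in>J. 4/3) \<le> (\<Sum>j\<in>J. measure_pmf.prob (seed A) (ok_int j) + measure_pmf.prob (seed A) (ok_disj j))"
  proof (intro sum_mono)
    fix j assume "j \<in> J"
    then obtain i D z where j: "j = (i, D, z)" "i \<in> I" "D \<subseteq> I" "z \<subseteq> I"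
      unfolding J_def by blast
    have "insert i (z - D) \<inter> insert i (z \<inter> D) \<noteq> {}" "(z - D) \<inter> (z \<inter> D) = {}"
      and sub: "insert i (z - D) \<subseteq> I" "insert i (z \<inter> D) \<subseteq> I" "z - D \<subseteq> I" "z \<inter> D \<subseteq> I"
      using j by auto
    then have "2/3 \<le> measure_pmf.prob (seed A) (ok_int j)" "2/3 \<le> measure_pmf.prob (seed A) (ok_disj j)"
      using prob[OF sub(1,2)] prob[OF sub(3,4)] by (simp_all only: ok_int_def ok_disj_def j(1) prod.case simp_thms)
    then show "4/3 \<le> measure_pmf.prob (seed A) (ok_int j) + measure_pmf.prob (seed A) (ok_disj j)"
      by linarith
  qed
  ultimately have "card J / 3 \<le> B"
    by simp
  then have "4 ^ n * (real n / 12) \<le> 4 ^ n * (24 * ln (real (card R)) + real n / 24)"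
    using cardJ by (simp add: B_def algebra_simps)
  then have "real n / 12 \<le> 24 * ln (real (card R)) + real n / 24"
    by (subst (asm) mult_le_cancel_left_pos) auto
  \<comment> \<open>There are \<open>2 ^ (2 * k * s)\<close> possible transcripts and
    \<open>ln 2 <= 1\<close>; so \<open>n / 24 <= 24 * 2 * k * s\<close>, which gives 1152.\<close>
  moreover have "ln (real (card R)) \<le> 2 * (real k * real s)"
    using ln_le_minus_one[of "2 :: real"] mult_left_mono[of "ln 2" 1 "real k * real s"]
    by (simp add: R ln_realpow mult_ac)
  ultimately show ?thesis
    by simp
qed

section \<open>Excluding space \<open>m / T^(1/2 + rho)\<close>\<close>

lemma solves_Dist_mono: "solves_Dist A k T F \<Longrightarrow> F' \<subseteq> F \<Longrightarrow> solves_Dist A k T F'"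
  by (auto simp: solves_Dist_def)

text \<open>Dense instances suffice: for \<open>t = n\<close>, \<open>V = 3 * n\<close> and
  \<open>m = 3 * n^2\<close> the assumed space is at most
  \<open>3 * C * n powr (1 - 2 * \<rho>)\<close>, too small for
  \<open>disj_family_space_bound\<close> once \<open>n\<close> is large.\<close>

lemma no_low_space_algorithm:
  fixes \<rho> C :: real
  assumes \<rho>: "\<rho> > 0"
    and alg: "\<And>V m t. V \<ge> N0 \<Longrightarrow> 1 \<le> t \<Longrightarrow> t \<le> V \<Longrightarrow>
            (\<exists>A s. real s \<le> C * real m / (real (t ^ 2)) powr (1/2 + \<rho>)
             \<and> space_bounded A s
             \<and> solves_Dist A k (t ^ 2)
                 {E. graph_on V E \<and> card E \<le> m
                     \<and> (card (triangles E) = 0 \<or> card (triangles E) \<ge> t ^ 2)})"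
  shows False
proof -
  \<comment> \<open>The lower bound will force \<open>n powr (2 * \<rho>) <= K\<close>, so
    \<open>n\<close> is taken beyond that; the maximum with 1 keeps \<open>K\<close> positive so
    that \<open>powr\<close> can be inverted.\<close>
  define K where "K = max 1 (1152 * k * (3 * C))"
  define n where "n = max (max 1 N0) (Suc (nat \<lceil>K powr (1 / (2 * \<rho>))\<rceil>))"
  have n: "1 \<le> n" "N0 \<le> n" "K powr (1 / (2 * \<rho>)) < n"
    unfolding n_def by linarith+
  have "K = (K powr (1 / (2 * \<rho>))) powr (2 * \<rho>)"
    using \<rho> by (simp add: powr_powr K_def)
  also have "\<dots> < n powr (2 * \<rho>)"
    using n \<rho> by (intro powr_less_mono2) auto
  finally have K: "K < n powr (2 * \<rho>)" .
  obtain A s where s: "real s \<le> C * real (3 * n * n) / (real (n ^ 2)) powr (1/2 + \<rho>)"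
    and A: "space_bounded A s"
      "solves_Dist A k (n ^ 2) {E. graph_on (3 * n) E \<and> card E \<le> 3 * n * n
                     \<and> (card (triangles E) = 0 \<or> card (triangles E) \<ge> n ^ 2)}"
    using alg[of "3 * n" n "3 * n * n"] n by auto
  have "solves_Dist A k (n\<^sup>2) (disj_family n n)"
    using disj_family[of n n] n by (intro solves_Dist_mono[OF A(2)]) auto
  then have "real n \<le> 1152 * (real k * real s)"
    using disj_family_space_bound[of n n A s k] A n by simp
  also have "\<dots> \<le> 1152 * (real k * (C * real (3 * n * n) / (real (n ^ 2)) powr (1/2 + \<rho>)))"
    using s by (intro mult_left_mono) auto
  also have "(real (n ^ 2)) powr (1/2 + \<rho>) = n * n powr (2 * \<rho>)"
  proof -
    have "real (n ^ 2) = n powr 2"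
      using n by (simp add: powr_numeral)
    then have "(real (n ^ 2)) powr (1/2 + \<rho>) = n powr (2 * (1/2 + \<rho>))"
      by (simp only: powr_powr)
    then show ?thesis
      using n by (simp add: powr_add distrib_left)
  qed
  also have "1152 * (real k * (C * real (3 * n * n) / (n * n powr (2 * \<rho>))))
     = 1152 * k * (3 * C) * n / n powr (2 * \<rho>)"
    using n by (simp add: field_simps)
  finally have "real n * n powr (2 * \<rho>) \<le> 1152 * k * (3 * C) * n"
    using n by (simp add: le_divide_eq)
  then have "n powr (2 * \<rho>) \<le> 1152 * k * (3 * C)"
    using n by (simp add: mult.commute)
  then show False
    using K by (simp add: K_def)
qed

theorem theorem4:
  shows "(\<forall>k::nat. k \<ge> 1 \<longrightarrow>
      (\<exists>c::real. c > 0 \<and> (\<exists>C1::nat. \<exists>c2 C2::real. c2 > 0 \<and> C2 > 0 \<and> (\<exists>N0::nat.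
        \<forall>n t::nat. n \<ge> N0 \<and> 1 \<le> t \<and> t \<le> n \<longrightarrow>
          (\<exists>F::nat set set set.
             (\<forall>E\<in>F. graph_on (C1 * n) E
                \<and> c2 * real n * real t \<le> real (card E)
                \<and> real (card E) \<le> C2 * real n * real t
                \<and> (card (triangles E) = 0 \<or> card (triangles E) \<ge> t ^ 2))
           \<and> (\<forall>(A::stream_alg) (s::nat). space_bounded A s \<and> solves_Dist A k (t ^ 2) F
                 \<longrightarrow> real s \<ge> c * real n))))))
    \<and>
    (\<forall>(\<rho>::real) (k::nat) (C::real). \<rho> > 0 \<longrightarrow>
      \<not> (\<exists>N0::nat. \<forall>V m t::nat. V \<ge> N0 \<and> 1 \<le> t \<and> t \<le> V \<longrightarrow>
            (\<exists>(A::stream_alg) (s::nat).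
               real s \<le> C * real m / (real (t ^ 2)) powr (1/2 + \<rho>)
             \<and> space_bounded A s
             \<and> solves_Dist A k (t ^ 2)
                 {E. graph_on V E \<and> card E \<le> m
                     \<and> (card (triangles E) = 0 \<or> card (triangles E) \<ge> t ^ 2)})))"
proof (intro conjI allI impI)
  fix k :: nat assume k: "k \<ge> 1"
  have bound: "1 / (1152 * k) * n \<le> s"
    if "n \<ge> 1" "1 \<le> t" "t \<le> n" "space_bounded A s" "solves_Dist A k (t ^ 2) (disj_family n t)"
    for n t A s
    using disj_family_space_bound[OF that(2-5)] k by (simp add: field_simps)
  show "\<exists>c::real. c > 0 \<and> (\<exists>C1::nat. \<exists>c2 C2::real. c2 > 0 \<and> C2 > 0 \<and> (\<exists>N0::nat.
        \<forall>n t::nat. n \<ge> N0 \<and> 1 \<le> t \<and> t \<le> n \<longrightarrow>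
          (\<exists>F::nat set set set.
             (\<forall>E\<in>F. graph_on (C1 * n) E
                \<and> c2 * real n * real t \<le> real (card E)
                \<and> real (card E) \<le> C2 * real n * real t
                \<and> (card (triangles E) = 0 \<or> card (triangles E) \<ge> t ^ 2))
           \<and> (\<forall>(A::stream_alg) (s::nat). space_bounded A s \<and> solves_Dist A k (t ^ 2) F
                 \<longrightarrow> real s \<ge> c * real n))))"
  \<comment> \<open>The witnesses are, in order, \<open>c\<close>, \<open>C1\<close>,
    \<open>c2\<close>, \<open>C2\<close> and \<open>N0\<close>; the middle three are the constants
    of \<open>disj_family\<close>.\<close>
  proof (rule exI[of _ "1 / (1152 * k)"], rule conjI, (use k in simp), rule exI[of _ 3], rule exI[of _ 1],
      rule exI[of _ 3], intro conjI exI[of _ "1 :: nat"] allI impI)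
    fix n t :: nat assume nt: "n \<ge> 1 \<and> 1 \<le> t \<and> t \<le> n"
    have "1 * real n * real t \<le> real (card E)" "real (card E) \<le> 3 * real n * real t"
      if "E \<in> disj_family n t" for E
      using disj_family(2,3)[of t n E, THEN of_nat_mono[where 'a = real]] that nt by simp_all
    then show "\<exists>F. (\<forall>E\<in>F. graph_on (3 * n) E
                \<and> 1 * real n * real t \<le> real (card E)
                \<and> real (card E) \<le> 3 * real n * real t
                \<and> (card (triangles E) = 0 \<or> card (triangles E) \<ge> t ^ 2))
           \<and> (\<forall>(A::stream_alg) (s::nat). space_bounded A s \<and> solves_Dist A k (t ^ 2) F
                 \<longrightarrow> real s \<ge> 1 / (1152 * k) * real n)"
      using disj_family(1,4)[of t n] bound[of n t] nt by (intro exI[of _ "disj_family n t"]) auto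
  qed auto
next
  fix \<rho> C :: real and k :: nat
  assume "\<rho> > 0"
  then show "\<not> (\<exists>N0::nat. \<forall>V m t::nat. V \<ge> N0 \<and> 1 \<le> t \<and> t \<le> V \<longrightarrow>
            (\<exists>(A::stream_alg) (s::nat).
               real s \<le> C * real m / (real (t ^ 2)) powr (1/2 + \<rho>)
             \<and> space_bounded A s
             \<and> solves_Dist A k (t ^ 2)
                 {E. graph_on V E \<and> card E \<le> m
                     \<and> (card (triangles E) = 0 \<or> card (triangles E) \<ge> t ^ 2)}))"
    using no_low_space_algorithm by blast
qed

end
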